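(* Let $\mathsf P$ be a network coding problem, $q$ a prime power, and $h\in\mathcal H[\mathcal S\cup\mathcal E]$ a $q$-representable function with $h\in\mathcal C_I(\mathsf P)\cap\mathcal C_T(\mathsf P)\cap\mathcal C_D(\mathsf P)$. Then the rate-capacity tuple $(\lambda,\omega)=\mathrm{proj}_{\mathsf P}[h]$ is $0$-achievable by $q$-linear network codes (i.e. $0$-achievable subject to the $q$-linearity constraint).
   Context: A network is $\mathsf G=(\mathcal V,\mathcal E)$, $\mathcal V$ a finite set of nodes, $\mathcal E$ a finite set of hyperedges, each $e$ with tail $\mathrm{tail}(e)\in\mathcal V$ and head $\mathrm{head}(e)\subseteq\mathcal V$, without directed cycles. A connection constraint $\mathsf M=(\mathcal S,O,D)$: finite source index set $\mathcal S$, $O:\mathcal S\to2^{\mathcal V}$ (where source $s$ is available), $D:\mathcal S\to2^{\mathcal V}$ (sinks of $s$). $\mathsf P=(\mathsf G,\mathsf M)$. Sources are imaginary edges with $\mathrm{head}(s)=O(s)$; $\mathrm{in}(e)=\{f\in\mathcal S\cup\mathcal E:\mathrm{tail}(e)\in\mathrm{head}(f)\}$, $\mathrm{in}(u)=\{f\in\mathcal S\cup\mathcal E:u\in\mathrm{head}(f)\}$. A $q$-linear network code is a family of random variables $\{Y_f:f\in\mathcal S\cup\mathcal E\}$ where each $Y_s$ is a row vector over $GF(q)$ with entries independent and uniform over $GF(q)$, the $Y_s$ are mutually independent, and each $Y_e$ is a row vector over $GF(q)$ that is a $GF(q)$-linear function of $(Y_f:f\in\mathrm{in}(e))$. $\mathrm{SP}(X)$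 is the support of $X$. A rate-capacity tuple $(\lambda,\omega)$ ($\lambda:\mathcal S\to\mathbb R_{\ge0}$, $\omega:\mathcal E\to\mathbb R_{\ge0}$) is $0$-achievable by $q$-linear network codes if there exist $q$-linear network codes $\{Y^n_f\}$ and $c_n>0$ with $\lim_nc_n\log|\mathrm{SP}(Y^n_s)|\ge\lambda(s)$, $\lim_nc_n\log|\mathrm{SP}(Y^n_e)|\le\omega(e)$, and $H(Y^n_s\mid Y^n_f,f\in\mathrm{in}(u))=0$ for all $n$, $s$, $u\in D(s)$. $\mathcal H[\mathcal S\cup\mathcal E]$ is the set of real functions on subsets of $\mathcal S\cup\mathcal E$, $h(\alpha\mid\beta)=h(\alpha\cup\beta)-h(\beta)$. $h$ is $q$-representable if there are subspaces $\mathbb U_i$ ($i\in\mathcal S\cup\mathcal E$) of a finite-dimensional $GF(q)$-vector space with $h(\alpha)=\dim\langle\mathbb U_i:i\in\alpha\rangle$ for all $\alpha$. $\mathcal C_I(\mathsf P)=\{h:h(\mathcal S)=\sum_sh(s)\}$, $\mathcal C_T(\mathsf P)=\{h:h(e\mid\mathrm{in}(e))=0\ \forall e\in\mathcal E\}$, $\mathcal C_D(\mathsf P)=\{h:h(s\mid\mathrm{in}(u))=0\ \forall s,u\in D(s)\}$. $\mathrm{proj}_{\mathsf P}[h]=(h(s),s\in\mathcal S;h(e),e\in\mathcal E)$. *)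

theory Defs
  imports "HOL-Analysis.Analysis"
begin

text \<open>Networks. Nodes have type 'v, hyperedges type 'e, source indices type 's.
  Sources and edges together are represented by the sum type ('s + 'e):
  Inl s is the (imaginary) source edge s, Inr e the hyperedge e.\<close>

definition is_network ::
  "'v set \<Rightarrow> 'e set \<Rightarrow> ('e \<Rightarrow> 'v) \<Rightarrow> ('e \<Rightarrow> 'v set) \<Rightarrow> bool" where
  "is_network V E tailE headE \<longleftrightarrow>
     finite V \<and> finite E \<and>
     (\<forall>e\<in>E. tailE e \<in> V \<and> headE e \<subseteq> V) \<and>
     acyclic {(tailE e, v) | e v. e \<in> E \<and> v \<in> headE e}"

definition is_connection_constraint ::
  "'v set \<Rightarrow> 's set \<Rightarrow> ('s \<Rightarrow> 'v set) \<Rightarrow> ('s \<Rightarrow> 'v set) \<Rightarrow> bool" where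
  "is_connection_constraint V S Orig D \<longleftrightarrow>
     finite S \<and> (\<forall>s\<in>S. Orig s \<subseteq> V \<and> D s \<subseteq> V)"

text \<open>The ground set S \<union> E.\<close>
definition ground :: "'s set \<Rightarrow> 'e set \<Rightarrow> ('s + 'e) set" where
  "ground S E = Inl ` S \<union> Inr ` E"

text \<open>Heads of sources and edges: head(s) = Orig(s).\<close>
fun headx :: "('s \<Rightarrow> 'v set) \<Rightarrow> ('e \<Rightarrow> 'v set) \<Rightarrow> ('s + 'e) \<Rightarrow> 'v set" where
  "headx Orig headE (Inl s) = Orig s"
| "headx Orig headE (Inr e) = headE e"

text \<open>in(e) for an edge e, and in(u) for a node u.\<close>
definition in_edge ::
  "'s set \<Rightarrow> 'e set \<Rightarrow> ('e \<Rightarrow> 'v) \<Rightarrow> ('e \<Rightarrow> 'v set) \<Rightarrow> ('s \<Rightarrow> 'v set) \<Rightarrow> 'e \<Rightarrow> ('s + 'e) set" where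
  "in_edge S E tailE headE Orig e = {f \<in> ground S E. tailE e \<in> headx Orig headE f}"

definition in_node ::
  "'s set \<Rightarrow> 'e set \<Rightarrow> ('e \<Rightarrow> 'v set) \<Rightarrow> ('s \<Rightarrow> 'v set) \<Rightarrow> 'v \<Rightarrow> ('s + 'e) set" where
  "in_node S E headE Orig u = {f \<in> ground S E. u \<in> headx Orig headE f}"

text \<open>Polymatroid-type regions. h is a real function on subsets of S \<union> E;
  h(a | b) = h(a \<union> b) - h(b).\<close>

definition C_I :: "'s set \<Rightarrow> (('s + 'e) set \<Rightarrow> real) \<Rightarrow> bool" where
  "C_I S h \<longleftrightarrow> h (Inl ` S) = (\<Sum>s\<in>S. h {Inl s})"

definition C_T ::
  "'s set \<Rightarrow> 'e set \<Rightarrow> ('e \<Rightarrow> 'v) \<Rightarrow> ('e \<Rightarrow> 'v set) \<Rightarrow> ('s \<Rightarrow> 'v set)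
   \<Rightarrow> (('s + 'e) set \<Rightarrow> real) \<Rightarrow> bool" where
  "C_T S E tailE headE Orig h \<longleftrightarrow>
     (\<forall>e\<in>E. h ({Inr e} \<union> in_edge S E tailE headE Orig e) - h (in_edge S E tailE headE Orig e) = 0)"

definition C_D ::
  "'s set \<Rightarrow> 'e set \<Rightarrow> ('e \<Rightarrow> 'v set) \<Rightarrow> ('s \<Rightarrow> 'v set) \<Rightarrow> ('s \<Rightarrow> 'v set)
   \<Rightarrow> (('s + 'e) set \<Rightarrow> real) \<Rightarrow> bool" where
  "C_D S E headE Orig D h \<longleftrightarrow>
     (\<forall>s\<in>S. \<forall>u\<in>D s. h ({Inl s} \<union> in_node S E headE Orig u) - h (in_node S E headE Orig u) = 0)"

text \<open>q-representability, with q = CARD('k) and the ambient finite-dimensional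
  GF(q)-space taken to be 'k^'n.\<close>
definition q_representable_by ::
  "'s set \<Rightarrow> 'e set \<Rightarrow> (('s + 'e) set \<Rightarrow> real) \<Rightarrow> (('s + 'e) \<Rightarrow> ('k::field ^ 'n::finite) set) \<Rightarrow> bool" where
  "q_representable_by S E h U \<longleftrightarrow>
     (\<forall>i\<in>ground S E. vec.subspace (U i)) \<and>
     (\<forall>\<alpha>\<subseteq>ground S E. h \<alpha> = real (vec.dim (\<Union>i\<in>\<alpha>. U i)))"

text \<open>q-linear network codes (q = CARD('k)). The joint source message is an
  element x of the message space: x s is the row vector of length k s (entries
  beyond position k s are 0) carried by source s. Drawing x uniformly from the
  message space makes the Y_s independent, each with i.i.d. uniform entries.
  Y f x is the value of the random variable Y_f at outcome x; vectors are
  encoded as functions nat => 'k, zero beyond their length.\<close>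

definition msg_space :: "'s set \<Rightarrow> ('s \<Rightarrow> nat) \<Rightarrow> ('s \<Rightarrow> nat \<Rightarrow> 'k::zero) set" where
  "msg_space S k = {x. \<forall>s j. (s \<notin> S \<or> k s \<le> j) \<longrightarrow> x s j = 0}"

fun vlen :: "('s \<Rightarrow> nat) \<Rightarrow> ('e \<Rightarrow> nat) \<Rightarrow> ('s + 'e) \<Rightarrow> nat" where
  "vlen k m (Inl s) = k s"
| "vlen k m (Inr e) = m e"

text \<open>Y is a q-linear network code with source lengths k and edge lengths m:
  Y_s is the source message and each Y_e is a GF(q)-linear function (given by
  matrices A) of (Y_f : f \<in> in(e)).\<close>
definition is_linear_code ::
  "'s set \<Rightarrow> 'e set \<Rightarrow> ('e \<Rightarrow> 'v) \<Rightarrow> ('e \<Rightarrow> 'v set) \<Rightarrow> ('s \<Rightarrow> 'v set)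
   \<Rightarrow> ('s \<Rightarrow> nat) \<Rightarrow> ('e \<Rightarrow> nat)
   \<Rightarrow> (('s + 'e) \<Rightarrow> ('s \<Rightarrow> nat \<Rightarrow> 'k::{field,finite}) \<Rightarrow> (nat \<Rightarrow> 'k)) \<Rightarrow> bool" where
  "is_linear_code S E tailE headE Orig k m Y \<longleftrightarrow>
     (\<forall>s\<in>S. \<forall>x\<in>msg_space S k. Y (Inl s) x = x s) \<and>
     (\<forall>e\<in>E. \<exists>A :: ('s + 'e) \<Rightarrow> nat \<Rightarrow> nat \<Rightarrow> 'k.
        \<forall>x\<in>msg_space S k. \<forall>j.
          Y (Inr e) x j =
            (if j < m e
             then (\<Sum>f\<in>in_edge S E tailE headE Orig e. \<Sum>i<vlen k m f. Y f x i * A f i j)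
             else 0))"

text \<open>Support SP(Y_f) of Y_f (the message is uniform with full support).\<close>
definition SP :: "'s set \<Rightarrow> ('s \<Rightarrow> nat) \<Rightarrow> (('s + 'e) \<Rightarrow> ('s \<Rightarrow> nat \<Rightarrow> 'k::zero) \<Rightarrow> 'b)
   \<Rightarrow> ('s + 'e) \<Rightarrow> 'b set" where
  "SP S k Y f = Y f ` msg_space S k"

text \<open>H(Y_s | Y_f, f \<in> F) = 0. Since the underlying message is uniform on the
  finite message space (full support), this holds iff Y_s is a function of
  (Y_f : f \<in> F) on the message space.\<close>
definition cond_entropy_zero ::
  "'s set \<Rightarrow> ('s \<Rightarrow> nat) \<Rightarrow> (('s + 'e) \<Rightarrow> ('s \<Rightarrow> nat \<Rightarrow> 'k::zero) \<Rightarrow> 'b)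
   \<Rightarrow> ('s + 'e) \<Rightarrow> ('s + 'e) set \<Rightarrow> bool" where
  "cond_entropy_zero S k Y g F \<longleftrightarrow>
     (\<forall>x\<in>msg_space S k. \<forall>x'\<in>msg_space S k.
        (\<forall>f\<in>F. Y f x = Y f x') \<longrightarrow> Y g x = Y g x')"

text \<open>0-achievability of (\<lambda>,\<omega>) by q-linear network codes, q = CARD('k).\<close>
definition zero_achievable_linear ::
  "'k::{field,finite} itself \<Rightarrow> 's set \<Rightarrow> 'e set \<Rightarrow> ('e \<Rightarrow> 'v) \<Rightarrow> ('e \<Rightarrow> 'v set)
   \<Rightarrow> ('s \<Rightarrow> 'v set) \<Rightarrow> ('s \<Rightarrow> 'v set) \<Rightarrow> ('s \<Rightarrow> real) \<Rightarrow> ('e \<Rightarrow> real) \<Rightarrow> bool" where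
  "zero_achievable_linear TYPE('k) S E tailE headE Orig D lam om \<longleftrightarrow>
     (\<exists>(k :: nat \<Rightarrow> 's \<Rightarrow> nat) (m :: nat \<Rightarrow> 'e \<Rightarrow> nat)
        (Y :: nat \<Rightarrow> ('s + 'e) \<Rightarrow> ('s \<Rightarrow> nat \<Rightarrow> 'k) \<Rightarrow> (nat \<Rightarrow> 'k)) (c :: nat \<Rightarrow> real).
       (\<forall>n. is_linear_code S E tailE headE Orig (k n) (m n) (Y n)) \<and>
       (\<forall>n. c n > 0) \<and>
       (\<forall>s\<in>S. \<exists>L. (\<lambda>n. c n * ln (real (card (SP S (k n) (Y n) (Inl s))))) \<longlonglongrightarrow> L
                 \<and> L \<ge> lam s) \<and>
       (\<forall>e\<in>E. \<exists>L. (\<lambda>n. c n * ln (real (card (SP S (k n) (Y n) (Inr e))))) \<longlonglongrightarrow> L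
                 \<and> L \<le> om e) \<and>
       (\<forall>n. \<forall>s\<in>S. \<forall>u\<in>D s. cond_entropy_zero S (k n) (Y n) (Inl s) (in_node S E headE Orig u)))"

text \<open>proj_P[h].\<close>
definition proj_src :: "(('s + 'e) set \<Rightarrow> real) \<Rightarrow> 's \<Rightarrow> real" where
  "proj_src h s = h {Inl s}"

definition proj_edge :: "(('s + 'e) set \<Rightarrow> real) \<Rightarrow> 'e \<Rightarrow> real" where
  "proj_edge h e = h {Inr e}"

end

theory Submission
  imports Defs
begin

text \<open>Choose a basis of each subspace \<open>U\<^sub>g\<close>. By \<open>C_I\<close> the source bases together are
  linearly independent, so every message \<open>x\<close> determines a linear functional \<open>\<phi>\<^sub>x\<close> sending
  the \<open>i\<close>-th basis vector of \<open>U\<^sub>s\<close> to \<open>x s i\<close>. Let \<open>Y\<^sub>g(x)\<close> be the vector of values of \<open>\<phi>\<^sub>x\<close>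
  at the basis vectors of \<open>U\<^sub>g\<close>; then \<open>Y\<^sub>s(x)\<close> is the message of \<open>s\<close>. By \<open>C_T\<close> (resp. \<open>C_D\<close>)
  \<open>U\<^sub>e\<close> (resp. \<open>U\<^sub>s\<close> for a sink \<open>u\<close> of \<open>s\<close>) lies in the span of the subspaces entering \<open>e\<close>
  (resp. \<open>u\<close>); the coefficients expressing its basis vectors do not depend on \<open>x\<close>, so \<open>Y\<close> is
  a linear code and \<open>u\<close> decodes \<open>s\<close>. The support of \<open>Y\<^sub>g\<close> has at most \<open>q\<^bsup>dim U\<^sub>g\<^esup>\<close>
  elements, with equality on the sources, so this single code, normalised by \<open>1 / ln q\<close>,
  achieves \<open>proj\<^sub>P[h]\<close>.\<close>

lemma subset_span_if_dim_Un_eq: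
  fixes A B :: "('k::field ^ 'n) set"
  assumes "vec.dim (A \<union> B) = vec.dim B"
  shows "A \<subseteq> vec.span B"
proof -
  have "vec.span B = vec.span (A \<union> B)"
    by (rule vec.dim_eq_span) (use assms in auto)
  then show ?thesis
    using vec.span_superset[of "A \<union> B"] by auto
qed

lemma span_image_eq_sum_scale:
  fixes g :: "'i \<Rightarrow> 'k::field ^ 'n"
  assumes "finite P" and "v \<in> vec.span (g ` P)"
  shows "\<exists>c. v = (\<Sum>p\<in>P. c p *s g p)"
  using assms(2)
proof (induction rule: vec.span_induct_alt)
  case base
  show ?case by (rule exI[of _ "\<lambda>_. 0"]) simp
next
  case (step a w y)
  then obtain p0 c where "p0 \<in> P" "w = g p0" "y = (\<Sum>p\<in>P. c p *s g p)" by blast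
  have "(\<Sum>p\<in>P. (c p + (if p = p0 then a else 0)) *s g p)
      = y + (\<Sum>p\<in>P. if p = p0 then a *s g p else 0)"
    unfolding \<open>y = _\<close> sum.distrib[symmetric]
    by (intro sum.cong) (simp_all add: vec.scale_left_distrib)
  also have "\<dots> = a *s w + y"
    using assms(1) \<open>p0 \<in> P\<close> \<open>w = g p0\<close> by (simp add: add.commute)
  finally have "a *s w + y = (\<Sum>p\<in>P. (c p + (if p = p0 then a else 0)) *s g p)" ..
  then show ?case by (rule exI[of _ "\<lambda>p. c p + (if p = p0 then a else 0)"])
qed

lemma inj_on_independent_if_card_le_dim:
  fixes g :: "'i \<Rightarrow> 'k::field ^ 'n"
  assumes "finite I" and "card I \<le> vec.dim (g ` I)"
  shows "inj_on g I" and "vec.independent (g ` I)"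
proof -
  have "vec.dim (g ` I) \<le> card (g ` I)"
    using assms(1) by (intro vec.dim_le_card) (auto intro: vec.span_base)
  moreover have "card (g ` I) \<le> card I" using assms(1) by (rule card_image_le)
  ultimately have card_eq: "card (g ` I) = card I" and "card (g ` I) \<le> vec.dim (g ` I)"
    using assms(2) by linarith+
  show "inj_on g I" using card_eq assms(1) by (simp add: inj_on_iff_eq_card)
  show "vec.independent (g ` I)"
    using assms(1) \<open>card (g ` I) \<le> vec.dim (g ` I)\<close>
    by (intro vec.card_le_dim_spanning[OF order_refl vec.span_superset]) auto
qed

lemma exists_linear_functional:
  fixes g :: "'i \<Rightarrow> 'k::field ^ 'n"
  assumes "inj_on g I" and "vec.independent (g ` I)"
  shows "\<exists>\<phi>. Vector_Spaces.linear (*s) (*) \<phi> \<and> (\<forall>p\<in>I. \<phi> (g p) = y p)"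
proof -
  interpret vector_space_pair "(*s) :: 'k \<Rightarrow> 'k ^ 'n \<Rightarrow> _" "(*) :: 'k \<Rightarrow> 'k \<Rightarrow> 'k"
    by unfold_locales
  obtain \<phi> where "Vector_Spaces.linear (*s) (*) \<phi>" "\<forall>v\<in>g ` I. \<phi> v = (y \<circ> inv_into I g) v"
    using linear_independent_extend[OF assms(2)] by blast
  then show ?thesis using assms(1) by auto
qed

lemma linear_combination_of_span_families:
  fixes b :: "'f \<Rightarrow> nat \<Rightarrow> 'k::field ^ 'n"
  assumes "finite F" and "v \<in> vec.span (\<Union>f\<in>F. b f ` {..<d f})"
  shows "\<exists>c. \<forall>\<phi>. Vector_Spaces.linear (*s) (*) \<phi> \<longrightarrow>
           \<phi> v = (\<Sum>f\<in>F. \<Sum>i<d f. \<phi> (b f i) * c f i)"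
proof -
  interpret vector_space_pair "(*s) :: 'k \<Rightarrow> 'k ^ 'n \<Rightarrow> _" "(*) :: 'k \<Rightarrow> 'k \<Rightarrow> 'k"
    by unfold_locales
  define P where "P = Sigma F (\<lambda>f. {..<d f})"
  have "(\<Union>f\<in>F. b f ` {..<d f}) = (\<lambda>p. b (fst p) (snd p)) ` P"
    by (force simp: P_def)
  moreover have "finite P" using assms(1) by (simp add: P_def)
  ultimately obtain c where c: "v = (\<Sum>p\<in>P. c p *s b (fst p) (snd p))"
    using span_image_eq_sum_scale assms(2) by metis
  have "\<phi> v = (\<Sum>f\<in>F. \<Sum>i<d f. \<phi> (b f i) * c (f, i))"
    if "Vector_Spaces.linear (*s) (*) \<phi>" for \<phi>
  proof -
    have "\<phi> v = (\<Sum>p\<in>P. \<phi> (b (fst p) (snd p)) * c p)"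
      using that by (simp add: c linear_sum linear_scale mult.commute)
    also have "\<dots> = (\<Sum>f\<in>F. \<Sum>i<d f. \<phi> (b f i) * c (f, i))"
      unfolding P_def using assms(1) by (simp add: sum.Sigma split_def)
    finally show ?thesis .
  qed
  then show ?thesis by (intro exI[of _ "\<lambda>f i. c (f, i)"]) blast
qed

text \<open>Since \<open>b\<close> spans \<open>W\<close> with \<open>dim W\<close> vectors, it enumerates a basis of \<open>W\<close>.\<close>

definition indexed_basis :: "('k::field ^ 'n) set \<Rightarrow> nat \<Rightarrow> (nat \<Rightarrow> 'k ^ 'n) \<Rightarrow> bool" where
  "indexed_basis W d b \<longleftrightarrow> vec.span (b ` {..<d}) = W \<and> vec.dim W = d"

lemma exists_indexed_bases:
  fixes U :: "'g \<Rightarrow> ('k::field ^ 'n) set"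
  assumes "\<And>g. g \<in> G \<Longrightarrow> vec.subspace (U g)"
  shows "\<exists>d b. \<forall>g\<in>G. indexed_basis (U g) (d g) (b g)"
proof -
  have "\<forall>g\<in>G. \<exists>p. indexed_basis (U g) (fst p) (snd p)"
  proof
    fix g assume "g \<in> G"
    obtain B where B: "B \<subseteq> U g" "vec.independent B" "U g \<subseteq> vec.span B" "card B = vec.dim (U g)"
      using vec.basis_exists by blast
    then have "finite B" using vec.finiteI_independent by blast
    then obtain b where "bij_betw b {..<card B} B"
      using ex_bij_betw_nat_finite by (auto simp: atLeast0LessThan)
    then have "vec.span (b ` {..<card B}) = U g"
      using B assms[OF \<open>g \<in> G\<close>] by (simp add: bij_betw_def vec.span_subspace)
    then have "indexed_basis (U g) (card B) b" using B(4) by (simp add: indexed_basis_def)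
    then show "\<exists>p. indexed_basis (U g) (fst p) (snd p)" by (intro exI[of _ "(card B, b)"]) simp
  qed
  from bchoice[OF this] obtain p where "\<forall>g\<in>G. indexed_basis (U g) (fst (p g)) (snd (p g))" ..
  then show ?thesis by (intro exI[of _ "fst \<circ> p"] exI[of _ "snd \<circ> p"]) simp
qed

lemma span_UN_indexed_bases:
  assumes "\<And>f. f \<in> F \<Longrightarrow> indexed_basis (U f) (d f) (b f)"
  shows "vec.span (\<Union>f\<in>F. U f) = vec.span (\<Union>f\<in>F. b f ` {..<d f})"
proof -
  have "U f \<subseteq> vec.span (\<Union>f\<in>F. b f ` {..<d f})" if "f \<in> F" for f
    using assms[OF that] that vec.span_mono[of "b f ` {..<d f}" "\<Union>f\<in>F. b f ` {..<d f}"]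
    by (auto simp: indexed_basis_def)
  moreover have "b f ` {..<d f} \<subseteq> vec.span (\<Union>f\<in>F. U f)" if "f \<in> F" for f
    using assms[OF that] that vec.span_superset[of "b f ` {..<d f}"]
      vec.span_superset[of "\<Union>f\<in>F. U f"]
    by (auto simp: indexed_basis_def)
  ultimately show ?thesis by (intro vec.span_eq[THEN iffD2]) blast
qed

definition vectors_of_length :: "nat \<Rightarrow> (nat \<Rightarrow> 'k::zero) set" where
  "vectors_of_length d = {v. \<forall>j. d \<le> j \<longrightarrow> v j = 0}"

lemma vectors_of_length_eq_image_PiE:
  "vectors_of_length d = (\<lambda>w j. if j < d then w j else 0) ` ({..<d} \<rightarrow>\<^sub>E UNIV)"
proof (intro set_eqI iffI)
  fix v assume "v \<in> vectors_of_length d"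
  then show "v \<in> (\<lambda>w j. if j < d then w j else 0) ` ({..<d} \<rightarrow>\<^sub>E UNIV)"
    by (intro image_eqI[of _ _ "restrict v {..<d}"]) (auto simp: vectors_of_length_def)
next
  fix v assume "v \<in> (\<lambda>w j. if j < d then w j else 0) ` ({..<d} \<rightarrow>\<^sub>E UNIV)"
  then show "v \<in> vectors_of_length d" by (force simp: vectors_of_length_def)
qed

lemma card_vectors_of_length:
  "card (vectors_of_length d :: (nat \<Rightarrow> 'k::{finite,zero}) set) = CARD('k) ^ d"
proof -
  have "inj_on (\<lambda>w j. if j < d then w j else (0::'k)) ({..<d} \<rightarrow>\<^sub>E UNIV)"
  proof (rule inj_onI)
    fix w w' assume w: "w \<in> {..<d} \<rightarrow>\<^sub>E UNIV" "w' \<in> {..<d} \<rightarrow>\<^sub>E UNIV"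
      and eq: "(\<lambda>j. if j < d then w j else 0) = (\<lambda>j. if j < d then w' j else (0::'k))"
    show "w = w'"
    proof (rule PiE_ext[OF w])
      fix i assume "i \<in> {..<d}"
      then show "w i = w' i" using fun_cong[OF eq, of i] by simp
    qed
  qed
  then show ?thesis
    by (simp add: vectors_of_length_eq_image_PiE card_image card_PiE)
qed

lemma finite_vectors_of_length:
  "finite (vectors_of_length d :: (nat \<Rightarrow> 'k::{finite,zero}) set)"
  by (simp add: vectors_of_length_eq_image_PiE finite_PiE)

lemma one_less_card_field: "1 < CARD('k::{field,finite})"
proof -
  have "card {0::'k, 1} \<le> CARD('k)" by (rule card_mono) simp_all
  then show ?thesis by simp
qed

lemma representable_span_if_cond_zero:
  assumes "q_representable_by S E h U" and "X \<union> F \<subseteq> ground S E"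
    and "h (X \<union> F) - h F = 0"
  shows "(\<Union>i\<in>X. U i) \<subseteq> vec.span (\<Union>i\<in>F. U i)"
proof (rule subset_span_if_dim_Un_eq)
  have "real (vec.dim (\<Union>i\<in>X \<union> F. U i)) = real (vec.dim (\<Union>i\<in>F. U i))"
    using assms by (auto simp: q_representable_by_def)
  then show "vec.dim ((\<Union>i\<in>X. U i) \<union> (\<Union>i\<in>F. U i)) = vec.dim (\<Union>i\<in>F. U i)"
    by (simp add: UN_Un)
qed

lemma representable_dim_sources:
  assumes "q_representable_by S E h U" and "C_I S h"
  shows "vec.dim (\<Union>s\<in>S. U (Inl s)) = (\<Sum>s\<in>S. vec.dim (U (Inl s)))"
proof -
  have "real (vec.dim (\<Union>s\<in>S. U (Inl s))) = h (Inl ` S)"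
    using assms(1) by (simp add: q_representable_by_def ground_def)
  also have "\<dots> = (\<Sum>s\<in>S. real (vec.dim (U (Inl s))))"
    using assms by (simp add: C_I_def q_representable_by_def ground_def)
  finally show ?thesis by (simp flip: of_nat_sum)
qed

definition induced_code ::
  "('g \<Rightarrow> nat) \<Rightarrow> ('g \<Rightarrow> nat \<Rightarrow> 'w) \<Rightarrow> ('x \<Rightarrow> 'w \<Rightarrow> 'k::zero) \<Rightarrow> 'g \<Rightarrow> 'x \<Rightarrow> nat \<Rightarrow> 'k" where
  "induced_code d b \<phi> g x j = (if j < d g then \<phi> x (b g j) else 0)"

lemma induced_code_combination:
  fixes b :: "'g \<Rightarrow> nat \<Rightarrow> 'k::field ^ 'n"
  assumes "\<And>x. Vector_Spaces.linear (*s) (*) (\<phi> x)" and "finite F"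
    and "b g ` {..<d g} \<subseteq> vec.span (\<Union>f\<in>F. b f ` {..<d f})"
  shows "\<exists>A. \<forall>x j. induced_code d b \<phi> g x j =
           (if j < d g then \<Sum>f\<in>F. \<Sum>i<d f. induced_code d b \<phi> f x i * A f i j else 0)"
proof -
  have "\<forall>j. \<exists>c. j < d g \<longrightarrow> (\<forall>x. \<phi> x (b g j) = (\<Sum>f\<in>F. \<Sum>i<d f. \<phi> x (b f i) * c f i))"
  proof
    fix j
    show "\<exists>c. j < d g \<longrightarrow> (\<forall>x. \<phi> x (b g j) = (\<Sum>f\<in>F. \<Sum>i<d f. \<phi> x (b f i) * c f i))"
    proof (cases "j < d g")
      case True
      then have "b g j \<in> vec.span (\<Union>f\<in>F. b f ` {..<d f})" using assms(3) by blast
      then obtain c where "\<forall>\<psi>. Vector_Spaces.linear (*s) (*) \<psi> \<longrightarrow>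
          \<psi> (b g j) = (\<Sum>f\<in>F. \<Sum>i<d f. \<psi> (b f i) * c f i)"
        using linear_combination_of_span_families[OF assms(2)] by blast
      then show ?thesis using assms(1) by blast
    qed simp
  qed
  from choice[OF this] obtain A where
    A: "\<forall>j. j < d g \<longrightarrow> (\<forall>x. \<phi> x (b g j) = (\<Sum>f\<in>F. \<Sum>i<d f. \<phi> x (b f i) * A j f i))"
    by blast
  show ?thesis
    by (rule exI[of _ "\<lambda>f i j. A j f i"]) (simp add: induced_code_def A)
qed

locale network_representation =
  fixes S :: "'s set" and E :: "'e set" and h :: "('s + 'e) set \<Rightarrow> real"
    and U :: "'s + 'e \<Rightarrow> ('k::{field,finite} ^ 'n::finite) set"
    and d :: "'s + 'e \<Rightarrow> nat" and b :: "'s + 'e \<Rightarrow> nat \<Rightarrow> 'k ^ 'n"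
  assumes finite_S: "finite S" and finite_E: "finite E"
    and representable: "q_representable_by S E h U"
    and indexed_bases: "g \<in> ground S E \<Longrightarrow> indexed_basis (U g) (d g) (b g)"
begin

lemma finite_ground: "finite (ground S E)"
  using finite_S finite_E by (simp add: ground_def)

lemma h_singleton: "g \<in> ground S E \<Longrightarrow> h {g} = real (d g)"
  using representable indexed_bases by (simp add: q_representable_by_def indexed_basis_def)

lemma basis_subset_span_if_cond_zero:
  assumes "g \<in> ground S E" and "F \<subseteq> ground S E" and "h ({g} \<union> F) - h F = 0"
  shows "b g ` {..<d g} \<subseteq> vec.span (\<Union>f\<in>F. b f ` {..<d f})"
proof -
  have "b g ` {..<d g} \<subseteq> U g"
    using indexed_bases[OF assms(1)] vec.span_superset[of "b g ` {..<d g}"]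
    by (simp add: indexed_basis_def)
  also have "\<dots> \<subseteq> vec.span (\<Union>f\<in>F. U f)"
  proof -
    have "{g} \<union> F \<subseteq> ground S E" using assms(1,2) by blast
    from representable_span_if_cond_zero[OF representable this assms(3)] show ?thesis by simp
  qed
  also have "\<dots> = vec.span (\<Union>f\<in>F. b f ` {..<d f})"
    by (rule span_UN_indexed_bases) (use indexed_bases assms(2) in blast)
  finally show ?thesis .
qed

lemma source_bases_independent:
  assumes "C_I S h"
  defines "I \<equiv> Sigma S (\<lambda>s. {..<d (Inl s)})" and "src \<equiv> \<lambda>p. b (Inl (fst p)) (snd p)"
  shows "inj_on src I" and "vec.independent (src ` I)"
proof -
  have basis: "indexed_basis (U (Inl s)) (d (Inl s)) (b (Inl s))" if "s \<in> S" for s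
    using indexed_bases that by (simp add: ground_def)
  have U_subset: "U (Inl s) \<subseteq> vec.span (src ` I)" if "s \<in> S" for s
  proof -
    have "b (Inl s) ` {..<d (Inl s)} \<subseteq> src ` I"
    proof
      fix v assume "v \<in> b (Inl s) ` {..<d (Inl s)}"
      then obtain i where "i < d (Inl s)" "v = src (s, i)" by (auto simp: src_def)
      then show "v \<in> src ` I" using that by (simp add: I_def)
    qed
    then have "vec.span (b (Inl s) ` {..<d (Inl s)}) \<subseteq> vec.span (src ` I)"
      by (rule vec.span_mono)
    with basis[OF that] show ?thesis by (simp add: indexed_basis_def)
  qed
  have "card I = (\<Sum>s\<in>S. vec.dim (U (Inl s)))"
    using finite_S basis by (simp add: I_def indexed_basis_def)
  also have "\<dots> = vec.dim (\<Union>s\<in>S. U (Inl s))"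
    using representable_dim_sources[OF representable assms(1)] ..
  also have "\<dots> \<le> vec.dim (src ` I)"
    using U_subset by (intro vec.dim_mono) blast
  finally have "card I \<le> vec.dim (src ` I)" .
  moreover have "finite I" using finite_S by (simp add: I_def)
  ultimately show "inj_on src I" and "vec.independent (src ` I)"
    using inj_on_independent_if_card_le_dim by blast+
qed

lemma exists_message_functional:
  assumes "C_I S h"
  obtains \<phi> :: "('s \<Rightarrow> nat \<Rightarrow> 'k) \<Rightarrow> 'k ^ 'n \<Rightarrow> 'k"
  where "\<And>x. Vector_Spaces.linear (*s) (*) (\<phi> x)"
    and "\<And>x s i. s \<in> S \<Longrightarrow> i < d (Inl s) \<Longrightarrow> \<phi> x (b (Inl s) i) = x s i"
proof -
  let ?I = "Sigma S (\<lambda>s. {..<d (Inl s)})"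
  have "\<forall>x. \<exists>\<psi>. Vector_Spaces.linear (*s) (*) \<psi> \<and>
      (\<forall>p\<in>?I. \<psi> (b (Inl (fst p)) (snd p)) = x (fst p) (snd p))"
  proof
    fix x :: "'s \<Rightarrow> nat \<Rightarrow> 'k"
    show "\<exists>\<psi>. Vector_Spaces.linear (*s) (*) \<psi> \<and>
        (\<forall>p\<in>?I. \<psi> (b (Inl (fst p)) (snd p)) = x (fst p) (snd p))"
      using exists_linear_functional[OF source_bases_independent[OF assms],
          of "\<lambda>p. x (fst p) (snd p)"] by simp
  qed
  from choice[OF this] obtain \<phi> where \<phi>: "\<forall>x. Vector_Spaces.linear (*s) (*) (\<phi> x) \<and>
      (\<forall>p\<in>?I. \<phi> x (b (Inl (fst p)) (snd p)) = x (fst p) (snd p))"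
    by blast
  show ?thesis
  proof (rule that)
    show "Vector_Spaces.linear (*s) (*) (\<phi> x)" for x using \<phi> by blast
    show "\<phi> x (b (Inl s) i) = x s i" if "s \<in> S" "i < d (Inl s)" for x s i
    proof -
      have "\<forall>p\<in>?I. \<phi> x (b (Inl (fst p)) (snd p)) = x (fst p) (snd p)" using \<phi> by blast
      moreover have "(s, i) \<in> ?I" using that by simp
      ultimately show ?thesis by fastforce
    qed
  qed
qed

end

locale network_code = network_representation S E h U d b
  for S :: "'s set" and E :: "'e set" and h :: "('s + 'e) set \<Rightarrow> real"
    and U :: "'s + 'e \<Rightarrow> ('k::{field,finite} ^ 'n::finite) set"
    and d :: "'s + 'e \<Rightarrow> nat" and b :: "'s + 'e \<Rightarrow> nat \<Rightarrow> 'k ^ 'n" +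
  fixes \<phi> :: "('s \<Rightarrow> nat \<Rightarrow> 'k) \<Rightarrow> 'k ^ 'n \<Rightarrow> 'k"
  assumes linear_message: "\<And>x. Vector_Spaces.linear (*s) (*) (\<phi> x)"
    and message_source: "\<And>x s i. s \<in> S \<Longrightarrow> i < d (Inl s) \<Longrightarrow> \<phi> x (b (Inl s) i) = x s i"
begin

abbreviation code :: "'s + 'e \<Rightarrow> ('s \<Rightarrow> nat \<Rightarrow> 'k) \<Rightarrow> nat \<Rightarrow> 'k" where
  "code \<equiv> induced_code d b \<phi>"

lemma code_source:
  assumes "s \<in> S" and "x \<in> msg_space S (d \<circ> Inl)"
  shows "code (Inl s) x = x s"
proof
  fix j
  show "code (Inl s) x j = x s j"
    using assms message_source by (auto simp: induced_code_def msg_space_def)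
qed

lemma code_combination:
  assumes "g \<in> ground S E" and "F \<subseteq> ground S E" and "h ({g} \<union> F) - h F = 0"
  shows "\<exists>A. \<forall>x j. code g x j =
           (if j < d g then \<Sum>f\<in>F. \<Sum>i<d f. code f x i * A f i j else 0)"
proof (rule induced_code_combination[OF linear_message])
  show "finite F" using assms(2) finite_ground by (rule finite_subset)
  show "b g ` {..<d g} \<subseteq> vec.span (\<Union>f\<in>F. b f ` {..<d f})"
    using assms by (rule basis_subset_span_if_cond_zero)
qed

lemma code_is_linear_code:
  assumes "C_T S E tailE headE Orig h"
  shows "is_linear_code S E tailE headE Orig (d \<circ> Inl) (d \<circ> Inr) code"
  unfolding is_linear_code_def
proof (intro conjI ballI)
  show "code (Inl s) x = x s" if "s \<in> S" and "x \<in> msg_space S (d \<circ> Inl)" for s x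
    using that by (rule code_source)
next
  fix e assume "e \<in> E"
  let ?F = "in_edge S E tailE headE Orig e"
  have "Inr e \<in> ground S E" using \<open>e \<in> E\<close> by (simp add: ground_def)
  moreover have "?F \<subseteq> ground S E" by (auto simp: in_edge_def)
  moreover have "h ({Inr e} \<union> ?F) - h ?F = 0" using assms \<open>e \<in> E\<close> by (simp add: C_T_def)
  ultimately obtain A where A: "\<forall>x j. code (Inr e) x j =
      (if j < d (Inr e) then \<Sum>f\<in>?F. \<Sum>i<d f. code f x i * A f i j else 0)"
    using code_combination by blast
  have "vlen (d \<circ> Inl) (d \<circ> Inr) f = d f" for f by (cases f) simp_all
  then show "\<exists>A. \<forall>x\<in>msg_space S (d \<circ> Inl). \<forall>j. code (Inr e) x j =
      (if j < (d \<circ> Inr) e then \<Sum>f\<in>?F. \<Sum>i<vlen (d \<circ> Inl) (d \<circ> Inr) f. code f x i * A f i j else 0)"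
    using A by auto
qed

lemma code_decodes:
  assumes "C_D S E headE Orig D h" and "s \<in> S" and "u \<in> D s"
  shows "cond_entropy_zero S (d \<circ> Inl) code (Inl s) (in_node S E headE Orig u)"
proof -
  let ?F = "in_node S E headE Orig u"
  have "Inl s \<in> ground S E" using assms(2) by (simp add: ground_def)
  moreover have "?F \<subseteq> ground S E" by (auto simp: in_node_def)
  moreover have "h ({Inl s} \<union> ?F) - h ?F = 0" using assms by (simp add: C_D_def)
  ultimately obtain A where A: "\<forall>x j. code (Inl s) x j =
      (if j < d (Inl s) then \<Sum>f\<in>?F. \<Sum>i<d f. code f x i * A f i j else 0)"
    using code_combination by blast
  show ?thesis
    unfolding cond_entropy_zero_def
  proof (intro ballI impI ext)
    fix x x' j assume "\<forall>f\<in>?F. code f x = code f x'"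
    then show "code (Inl s) x j = code (Inl s) x' j" by (simp add: A)
  qed
qed

lemma SP_code_source:
  assumes "s \<in> S"
  shows "SP S (d \<circ> Inl) code (Inl s) = vectors_of_length (d (Inl s))"
proof (intro set_eqI iffI)
  fix v assume "v \<in> SP S (d \<circ> Inl) code (Inl s)"
  then obtain x where "x \<in> msg_space S (d \<circ> Inl)" "v = code (Inl s) x"
    by (auto simp: SP_def)
  then show "v \<in> vectors_of_length (d (Inl s))"
    using assms code_source by (simp add: msg_space_def vectors_of_length_def)
next
  fix v :: "nat \<Rightarrow> 'k" assume v: "v \<in> vectors_of_length (d (Inl s))"
  let ?x = "\<lambda>t. if t = s then v else (\<lambda>_. 0)"
  have x: "?x \<in> msg_space S (d \<circ> Inl)"
    using v assms by (auto simp: msg_space_def vectors_of_length_def)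
  moreover have "code (Inl s) ?x = v" using code_source[OF assms x] by simp
  ultimately show "v \<in> SP S (d \<circ> Inl) code (Inl s)" unfolding SP_def by (metis image_eqI)
qed

lemma SP_code_subset: "SP S (d \<circ> Inl) code g \<subseteq> vectors_of_length (d g)"
  by (auto simp: SP_def induced_code_def vectors_of_length_def)

lemma SP_code_nonempty: "SP S (d \<circ> Inl) code g \<noteq> {}"
proof -
  have "(\<lambda>_ _. 0) \<in> msg_space S (d \<circ> Inl)" by (simp add: msg_space_def)
  then show ?thesis unfolding SP_def by blast
qed

lemma log_card_SP_code_source:
  assumes "s \<in> S"
  shows "log (real CARD('k)) (card (SP S (d \<circ> Inl) code (Inl s))) = real (d (Inl s))"
  using one_less_card_field[where 'k='k]
  by (simp add: SP_code_source[OF assms] card_vectors_of_length log_nat_power)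

lemma log_card_SP_code_le:
  "log (real CARD('k)) (card (SP S (d \<circ> Inl) code g)) \<le> real (d g)"
proof -
  have q: "1 < real CARD('k)" using one_less_card_field[where 'k='k] by simp
  have "finite (SP S (d \<circ> Inl) code g)"
    using SP_code_subset finite_vectors_of_length by (rule finite_subset)
  then have "0 < card (SP S (d \<circ> Inl) code g)"
    using SP_code_nonempty by (simp add: card_gt_0_iff)
  moreover have "card (SP S (d \<circ> Inl) code g) \<le> CARD('k) ^ d g"
    using card_mono[OF finite_vectors_of_length SP_code_subset]
    by (simp add: card_vectors_of_length)
  ultimately have "log (real CARD('k)) (card (SP S (d \<circ> Inl) code g))
      \<le> log (real CARD('k)) (real CARD('k) ^ d g)"
    using q by (intro log_mono) (simp_all flip: of_nat_power)
  also have "\<dots> = real (d g)" using q by (simp add: log_nat_power)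
  finally show ?thesis .
qed

end

lemma zero_achievable_linear_by_code:
  fixes Y :: "'s + 'e \<Rightarrow> ('s \<Rightarrow> nat \<Rightarrow> 'k::{field,finite}) \<Rightarrow> nat \<Rightarrow> 'k"
  assumes "is_linear_code S E tailE headE Orig k m Y"
    and "\<And>s. s \<in> S \<Longrightarrow> lam s \<le> log (real CARD('k)) (card (SP S k Y (Inl s)))"
    and "\<And>e. e \<in> E \<Longrightarrow> log (real CARD('k)) (card (SP S k Y (Inr e))) \<le> om e"
    and "\<And>s u. s \<in> S \<Longrightarrow> u \<in> D s \<Longrightarrow> cond_entropy_zero S k Y (Inl s) (in_node S E headE Orig u)"
  shows "zero_achievable_linear TYPE('k) S E tailE headE Orig D lam om"
proof -
  define c where "c = 1 / ln (real CARD('k))"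
  have "0 < c" using one_less_card_field[where 'k='k] by (simp add: c_def)
  moreover have "c * ln N = log (real CARD('k)) N" for N by (simp add: c_def log_def)
  ultimately show ?thesis
    unfolding zero_achievable_linear_def using assms
    by (intro exI[of _ "\<lambda>_. k"] exI[of _ "\<lambda>_. m"] exI[of _ "\<lambda>_. Y"] exI[of _ "\<lambda>_. c"]) auto
qed

theorem proposition4:
  fixes V :: "'v set" and E :: "'e set" and tailE :: "'e \<Rightarrow> 'v" and headE :: "'e \<Rightarrow> 'v set"
    and S :: "'s set" and Orig :: "'s \<Rightarrow> 'v set" and D :: "'s \<Rightarrow> 'v set"
    and h :: "('s + 'e) set \<Rightarrow> real"
    and U :: "('s + 'e) \<Rightarrow> ('k::{field,finite} ^ 'n::finite) set"
  assumes "is_network V E tailE headE"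
    and "is_connection_constraint V S Orig D"
    and "q_representable_by S E h U"
    and "C_I S h"
    and "C_T S E tailE headE Orig h"
    and "C_D S E headE Orig D h"
  shows "zero_achievable_linear TYPE('k) S E tailE headE Orig D (proj_src h) (proj_edge h)"
proof -
  obtain d b where bases: "\<forall>g\<in>ground S E. indexed_basis (U g) (d g) (b g)"
    using exists_indexed_bases[of "ground S E" U] assms(3) by (auto simp: q_representable_by_def)
  interpret R: network_representation S E h U d b
    using assms(1-3) bases by unfold_locales (simp_all add: is_network_def is_connection_constraint_def)
  obtain \<phi> where "\<And>x. Vector_Spaces.linear (*s) (*) (\<phi> x)"
    and "\<And>x s i. s \<in> S \<Longrightarrow> i < d (Inl s) \<Longrightarrow> \<phi> x (b (Inl s) i) = x s i"
    using R.exists_message_functional[OF assms(4)] by blast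
  then interpret C: network_code S E h U d b \<phi>
    by (intro network_code.intro R.network_representation_axioms network_code_axioms.intro)
  show ?thesis
  proof (rule zero_achievable_linear_by_code)
    show "is_linear_code S E tailE headE Orig (d \<circ> Inl) (d \<circ> Inr) C.code"
      using assms(5) by (rule C.code_is_linear_code)
    show "proj_src h s \<le> log (real CARD('k)) (card (SP S (d \<circ> Inl) C.code (Inl s)))" if "s \<in> S" for s
      using that by (simp add: proj_src_def R.h_singleton ground_def C.log_card_SP_code_source)
    show "log (real CARD('k)) (card (SP S (d \<circ> Inl) C.code (Inr e))) \<le> proj_edge h e" if "e \<in> E" for e
      using that C.log_card_SP_code_le[of "Inr e"] by (simp add: proj_edge_def R.h_singleton ground_def)
    show "cond_entropy_zero S (d \<circ> Inl) C.code (Inl s) (in_node S E headE Orig u)"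
      if "s \<in> S" and "u \<in> D s" for s u
      using assms(6) that by (rule C.code_decodes)
  qed
qed

end
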